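(* Let $(J,R,Q,B)\in\Sigma_{n,m}$ and $S\in\mathbb{K}^{m\times m}$ with $S^H=S\ge0$. Let $\mu\in\mathbb{K}\setminus\big(\sigma((J-R)Q)\cup\sigma(-((J-R)Q)^H)\big)$ be such that $\mu\mathcal{E}-\mathcal{A}_S$ is invertible, and let $E_1,E_2,E_3,E_4:\mathbb{R}\to\mathbb{K}^{n\times n}$ be such that for all $t\in\mathbb{R}$ $$e^{-[N_\mu^D(I-\mu N_\mu)](t-t_0)}=\begin{bmatrix}E_1(t)&E_2(t)\\ E_3(t)&E_4(t)\end{bmatrix}.$$ If $E_3(t_1)$ is invertible, then the differential-algebraic equation $$\frac{\mathrm{d}}{\mathrm{d}t}\mathcal{E}\begin{bmatrix}\lambda\\ x\\ u\end{bmatrix}=\mathcal{A}_S\begin{bmatrix}\lambda\\ x\\ u\end{bmatrix}$$ possesses a solution $(\lambda,x,u)\in\mathcal{C}^1([t_0,t_1],\mathbb{K}^{n+n+m})$ with $x(t_0)=x^0$ and $x(t_1)=x^1$ if and only if $$\begin{bmatrix}E_3(t_1)^{-1}[x^1-E_4(t_1)x^0]\\ x^0\end{bmatrix}\in\operatorname{im}(N_\mu^DN_\mu).$$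
   Context: $\mathbb{K}\in\{\mathbb{R},\mathbb{C}\}$, $n,m$ are positive integers, $t_0<t_1$ are real, $x^0,x^1\in\mathbb{K}^n$, $A^H$ is the conjugate transpose, $\sigma(A)$ is the set of (complex) eigenvalues of $A$, and $A\ge0$ means $x^HAx\ge0$ for all $x$. $\Sigma_{n,m}$ is the set of all $(J,R,Q,B)\in(\mathbb{K}^{n\times n})^3\times\mathbb{K}^{n\times m}$ with $J=-J^H$, $R=R^H\ge0$, $Q=Q^H\ge0$. The matrices of the optimality system are $$\mathcal{E}=\begin{bmatrix}0_{n\times n}&I_n&0_{n\times m}\\-I_n&0_{n\times n}&0_{n\times m}\\0_{m\times n}&0_{m\times n}&0_{m\times m}\end{bmatrix},\qquad \mathcal{A}_S=\begin{bmatrix}0_{n\times n}&(J-R)Q&B\\((J-R)Q)^H&QRQ&0_{n\times m}\\ B^H&0_{m\times n}&S\end{bmatrix}.$$ For $\mu$ as in the claim, $$E_\mu:=\begin{bmatrix}0&(J-R)Q-\mu I\\((J-R)Q)^H+\mu I&QRQ\end{bmatrix}^{-1},\qquad S_\mu:=S-\begin{bmatrix}B^H&0\end{bmatrix}E_\mu\begin{bmatrix}B\\0\end{bmatrix},$$ $$N_\mu:=\left(E_\mu+E_\mu\begin{bmatrix}B\\0\end{bmatrix}S_\mu^{-1}\begin{bmatrix}B^H&0\end{bmatrix}E_\mu\right)\begin{bmatrix}0&-I\\ I&0\end{bmatrix}\in\mathbb{K}^{2n\times2n}$$ ($S_\mu$ is invertible whenever $\mu\mathcal{E}-\mathcal{A}_S$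 is). The Drazin inverse $M^D$ of a square matrix $M$ is the unique matrix with $M^DM=MM^D$, $M^DMM^D=M^D$ and $M^DM^{\nu+1}=M^\nu$ for some $\nu\in\mathbb{N}_0$. *)

theory Defs
  imports "HOL-Analysis.Analysis" "HOL-Library.Nonpos_Ints"
begin

section \<open>The scalar field\<close>

text \<open>The class of scalar fields that are \<open>\<real>\<close> or \<open>\<complex>\<close>: a normed field together with its
  canonical embedding into the complex numbers and the corresponding conjugation.\<close>

class real_or_complex = real_normed_field + banach +
  fixes cembed :: "'a \<Rightarrow> complex"
    and kcnj :: "'a \<Rightarrow> 'a"
  assumes cembed_add: "cembed (x + y) = cembed x + cembed y"
    and cembed_mult: "cembed (x * y) = cembed x * cembed y"
    and cembed_scaleR: "cembed (r *\<^sub>R x) = r *\<^sub>R cembed x"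
    and norm_cembed: "norm (cembed x) = norm x"
    and cembed_kcnj: "cembed (kcnj x) = cnj (cembed x)"

instantiation real :: real_or_complex
begin
definition cembed_real :: "real \<Rightarrow> complex" where "cembed_real = complex_of_real"
definition kcnj_real :: "real \<Rightarrow> real" where "kcnj_real x = x"
instance
  by standard (simp_all add: cembed_real_def kcnj_real_def scaleR_conv_of_real)
end

instantiation complex :: real_or_complex
begin
definition cembed_complex :: "complex \<Rightarrow> complex" where "cembed_complex z = z"
definition kcnj_complex :: "complex \<Rightarrow> complex" where "kcnj_complex = cnj"
instance
  by standard (simp_all add: cembed_complex_def kcnj_complex_def)
end

text \<open>Since \<open>cembed\<close> is an isometric homomorphism of real algebras, the following shows that the
  class contains nothing but \<open>\<real>\<close> and \<open>\<complex>\<close> up to isomorphism.\<close>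

lemma cembed_1: "cembed (1 :: 'a::real_or_complex) = 1"
proof -
  have "cembed (1 :: 'a) * cembed (1 :: 'a) = cembed (1 :: 'a)"
    by (metis cembed_mult mult_1)
  moreover have "cembed (1 :: 'a) \<noteq> 0"
    by (metis norm_cembed norm_one norm_zero zero_neq_one)
  ultimately show ?thesis by simp
qed

lemma range_cembed:
  "range (cembed :: 'a::real_or_complex \<Rightarrow> complex) = \<real> \<or>
   range (cembed :: 'a::real_or_complex \<Rightarrow> complex) = UNIV"
proof (cases "range (cembed :: 'a \<Rightarrow> complex) \<subseteq> \<real>")
  case True
  have "complex_of_real r = cembed (r *\<^sub>R (1 :: 'a))" for r
    by (simp only: cembed_scaleR cembed_1) (simp add: scaleR_conv_of_real)
  then have "\<real> \<subseteq> range (cembed :: 'a \<Rightarrow> complex)"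
    unfolding Reals_def by blast
  with True show ?thesis by blast
next
  case False
  then obtain x :: 'a where "cembed x \<notin> \<real>" by blast
  then have im: "Im (cembed x) \<noteq> 0" by (simp add: complex_is_Real_iff)
  have "\<exists>y :: 'a. z = cembed y" for z
  proof -
    define b where "b = Im z / Im (cembed x)"
    define y where "y = b *\<^sub>R x + (Re z - b * Re (cembed x)) *\<^sub>R (1 :: 'a)"
    have "z = cembed y"
      using im by (simp add: y_def b_def cembed_add cembed_scaleR cembed_1 complex_eq_iff)
    then show ?thesis by blast
  qed
  then have "range (cembed :: 'a \<Rightarrow> complex) = UNIV" by (metis surj_def)
  then show ?thesis ..
qed


section \<open>Matrices\<close>

text \<open>\<open>vcat\<close> stacks vectors; applied to matrices, which are vectors of rows, it stacks blocks
  vertically.\<close>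

definition vcat :: "'b^'r \<Rightarrow> 'b^'s \<Rightarrow> 'b^('r + 's)" where
  "vcat X Y = (\<chi> i. case i of Inl r \<Rightarrow> X $ r | Inr s \<Rightarrow> Y $ s)"

definition hcat :: "'a^'c^'r \<Rightarrow> 'a^'d^'r \<Rightarrow> 'a^('c + 'd)^'r" where
  "hcat A B = (\<chi> i. vcat (A $ i) (B $ i))"

definition block22 ::
  "'a^'c^'r \<Rightarrow> 'a^'d^'r \<Rightarrow> 'a^'c^'s \<Rightarrow> 'a^'d^'s \<Rightarrow> 'a^('c + 'd)^('r + 's)" where
  "block22 A B C D = vcat (hcat A B) (hcat C D)"

definition ctranspose :: "'a::real_or_complex^'n^'m \<Rightarrow> 'a^'m^'n"  (\<open>_\<^sup>H\<close> [1000] 999) where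
  "A\<^sup>H = (\<chi> i j. kcnj (A $ j $ i))"

text \<open>\<open>A \<ge> 0\<close>, i.e. \<open>x\<^sup>HAx \<ge> 0\<close> for all \<open>x\<close>; the set \<open>nonneg_Reals\<close> consists of the non-negative real
  elements of the field.\<close>

definition psd :: "'a::real_or_complex^'n^'n \<Rightarrow> bool" where
  "psd A \<longleftrightarrow> (\<forall>x. (\<Sum>i\<in>UNIV. kcnj (x $ i) * (A *v x) $ i) \<in> nonneg_Reals)"

text \<open>The complex eigenvalues, also for a real matrix.\<close>

definition spectrum :: "'a::real_or_complex^'n^'n \<Rightarrow> complex set" where
  "spectrum A = {z. \<exists>v :: complex^'n. v \<noteq> 0 \<and> map_matrix cembed A *v v = z *s v}"

primrec matpow :: "'a::semiring_1^'n^'n \<Rightarrow> nat \<Rightarrow> 'a^'n^'n" where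
  "matpow A 0 = mat 1"
| "matpow A (Suc k) = A ** matpow A k"

definition mexp :: "'a::real_or_complex^'n^'n \<Rightarrow> 'a^'n^'n" where
  "mexp A = (\<Sum>k. (1 / fact k) *\<^sub>R matpow A k)"

definition drazin :: "'a::real_or_complex^'n^'n \<Rightarrow> 'a^'n^'n" where
  "drazin M = (THE D. D ** M = M ** D \<and> D ** M ** D = D \<and>
                      (\<exists>\<nu>. D ** matpow M (\<nu> + 1) = matpow M \<nu>))"


section \<open>The optimality system\<close>

definition Sigma_nm ::
  "(('a::real_or_complex^'n^'n) \<times> ('a^'n^'n) \<times> ('a^'n^'n) \<times> ('a^'m^'n)) set" where
  "Sigma_nm = {(J, R, Q, B). J = - (J\<^sup>H) \<and> R = R\<^sup>H \<and> psd R \<and> Q = Q\<^sup>H \<and> psd Q}"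

definition E_mat ::
  "'a::real_or_complex^('n::finite + ('n + 'm::finite))^('n + ('n + 'm))" where
  "E_mat = vcat (hcat 0 (hcat (mat 1) 0))
          (vcat (hcat (- mat 1) (hcat 0 0))
                (hcat 0 (hcat 0 0)))"

definition A_mat ::
  "'a::real_or_complex^'n::finite^'n \<Rightarrow> 'a^'n^'n \<Rightarrow> 'a^'n^'n \<Rightarrow> 'a^'m::finite^'n \<Rightarrow> 'a^'m^'m
    \<Rightarrow> 'a^('n + ('n + 'm))^('n + ('n + 'm))" where
  "A_mat J R Q B S =
     vcat (hcat 0 (hcat ((J - R) ** Q) B))
    (vcat (hcat (((J - R) ** Q)\<^sup>H) (hcat (Q ** R ** Q) 0))
          (hcat (B\<^sup>H) (hcat 0 S)))"

definition E_mu ::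
  "'a::real_or_complex^'n::finite^'n \<Rightarrow> 'a^'n^'n \<Rightarrow> 'a^'n^'n \<Rightarrow> 'a \<Rightarrow> 'a^('n + 'n)^('n + 'n)" where
  "E_mu J R Q \<mu> =
     matrix_inv (block22 0 ((J - R) ** Q - mat \<mu>)
                         (((J - R) ** Q)\<^sup>H + mat \<mu>) (Q ** R ** Q))"

definition S_mu ::
  "'a::real_or_complex^'n::finite^'n \<Rightarrow> 'a^'n^'n \<Rightarrow> 'a^'n^'n \<Rightarrow> 'a^'m::finite^'n \<Rightarrow> 'a^'m^'m \<Rightarrow> 'a
    \<Rightarrow> 'a^'m^'m" where
  "S_mu J R Q B S \<mu> = S - hcat (B\<^sup>H) 0 ** E_mu J R Q \<mu> ** vcat B 0"

definition N_mu ::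
  "'a::real_or_complex^'n::finite^'n \<Rightarrow> 'a^'n^'n \<Rightarrow> 'a^'n^'n \<Rightarrow> 'a^'m::finite^'n \<Rightarrow> 'a^'m^'m \<Rightarrow> 'a
    \<Rightarrow> 'a^('n + 'n)^('n + 'n)" where
  "N_mu J R Q B S \<mu> =
     (E_mu J R Q \<mu> +
      E_mu J R Q \<mu> ** vcat B 0 ** matrix_inv (S_mu J R Q B S \<mu>) ** hcat (B\<^sup>H) 0 ** E_mu J R Q \<mu>)
     ** block22 0 (- mat 1) (mat 1) 0"

text \<open>\<open>C\<^sup>1\<close> on a closed interval with one-sided derivatives at the endpoints; the library's
  \<open>C1_differentiable_on\<close> would ask for two-sided ones.\<close>

definition C1_on :: "real \<Rightarrow> real \<Rightarrow> (real \<Rightarrow> 'b::real_normed_vector) \<Rightarrow> bool" where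
  "C1_on t0 t1 z \<longleftrightarrow>
     (\<exists>z'. continuous_on {t0..t1} z' \<and>
           (\<forall>t\<in>{t0..t1}. (z has_vector_derivative z' t) (at t within {t0..t1})))"

definition dae_solution ::
  "'a::real_or_complex^'k^'k \<Rightarrow> 'a^'k^'k \<Rightarrow> real \<Rightarrow> real \<Rightarrow> (real \<Rightarrow> 'a^'k) \<Rightarrow> bool" where
  "dae_solution E A t0 t1 z \<longleftrightarrow> C1_on t0 t1 z \<and>
     (\<forall>t\<in>{t0..t1}.
        ((\<lambda>s. E *v z s) has_vector_derivative (A *v z t)) (at t within {t0..t1}))"

end

theory Submission
  imports Defs
begin

text \<open>
  Write \<open>F = (J - R)Q\<close>, \<open>z = (\<lambda>, x)\<close> and \<open>K = [0, -I; I, 0]\<close>. The optimality system says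
  \<open>-K z' = [0, F; F\<^sup>H, QRQ] z + [B; 0] u\<close> and \<open>0 = [B\<^sup>H, 0] z + S u\<close>. Subtracting \<open>-\<mu> K z\<close> on both
  sides of the first equation turns its coefficient of \<open>z\<close> into the block matrix whose inverse is
  \<open>E\<^sub>\<mu>\<close>. It is invertible, as its antidiagonal blocks \<open>F - \<mu> I\<close> and \<open>F\<^sup>H + \<mu> I\<close> are. Solving the two
  equations for \<open>z\<close> and \<open>u\<close> by the Schur complement \<open>S\<^sub>\<mu>\<close> (\<open>schur_complement_solve\<close>) shows that the
  system is equivalent to \<open>z = -N\<^sub>\<mu> (z' - \<mu> z)\<close>, together with a formula for \<open>u\<close> in terms of \<open>z\<close> and
  \<open>z'\<close> (\<open>optimality_system_iff\<close>).

  So with \<open>N = N\<^sub>\<mu>\<close> everything reduces to the singular system \<open>N z' = -(I - \<mu> N) z\<close>. Let \<open>D\<close> be the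
  Drazin inverse of \<open>N\<close>. Then \<open>D N\<close> is a projection commuting with \<open>N\<close>, and \<open>N\<close> is nilpotent on its
  kernel. The kernel component of a solution must vanish, because the powers of \<open>N\<close> can be stripped
  off it one at a time; on the image of \<open>D N\<close> one can multiply by \<open>D\<close> and obtains the ordinary equation
  \<open>z' = G z\<close> with \<open>G = -D(I - \<mu> N)\<close>. Hence the solutions are exactly the curves
  \<open>z(t) = exp((t - t\<^sub>0) G) v\<close> with \<open>v\<close> in the image of \<open>D N\<close>
  (\<open>singular_system_solution_unique\<close>, \<open>singular_system_exp_solution\<close>).

  The lower half of \<open>z(t\<^sub>1)\<close> is \<open>E\<^sub>3(t\<^sub>1) \<lambda>(t\<^sub>0) + E\<^sub>4(t\<^sub>1) x(t\<^sub>0)\<close>. As \<open>E\<^sub>3(t\<^sub>1)\<close> is invertible, the two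
  boundary conditions determine \<open>\<lambda>(t\<^sub>0)\<close>, so that there is only one candidate for \<open>v\<close>, and a solution
  exists precisely if this candidate lies in the image of \<open>D N\<close>.
\<close>

section \<open>The Drazin inverse\<close>

lemma matpow_add: "matpow A (j + k) = matpow A j ** matpow A k"
  by (induction j) (simp_all add: matrix_mul_assoc)

lemma matpow_Suc_right: "matpow A (Suc k) = matpow A k ** A"
  using matpow_add[of A k 1] by simp

lemma matpow_commute:
  assumes "A ** X = X ** A"
  shows "matpow A k ** X = X ** matpow A k"
  by (induction k) (simp, metis assms matpow.simps(2) matrix_mul_assoc)

definition is_drazin :: "'a::semiring_1^'n^'n \<Rightarrow> 'a^'n^'n \<Rightarrow> bool" where
  "is_drazin M D \<longleftrightarrow> D ** M = M ** D \<and> D ** M ** D = D \<and>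
     (\<exists>\<nu>. D ** matpow M (\<nu> + 1) = matpow M \<nu>)"

text \<open>The ranges of the powers of \<open>A\<close> decrease. A power whose range has minimal dimension has the same
  range as its successor, so each of its columns is the image of some vector under the successor;
  these vectors are the columns of \<open>X\<close>.\<close>

lemma matpow_factor_right:
  fixes A :: "'a::field^'n^'n"
  shows "\<exists>k X. matpow A k = matpow A (Suc k) ** X"
proof -
  let ?r = "\<lambda>k. range ((*v) (matpow A k))"
  obtain k where k: "\<And>j. vec.dim (?r k) \<le> vec.dim (?r j)"
    using ex_has_least_nat[of "\<lambda>_. True" _ "\<lambda>k. vec.dim (?r k)"] by auto
  have sub: "?r (Suc k) \<subseteq> ?r k"
    unfolding matpow_Suc_right by (auto simp flip: matrix_vector_mul_assoc)
  have "?r (Suc k) = ?r k"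
    using k[of "Suc k"] sub by (intro vec.subspace_dim_equal vec.subspace_image) auto
  then have "\<forall>v. \<exists>w. matpow A k *v v = matpow A (Suc k) *v w"
    by (metis rangeE rangeI)
  then obtain w where w: "\<And>v. matpow A k *v v = matpow A (Suc k) *v w v"
    by metis
  define X :: "'a^'n^'n" where "X = transpose (\<chi> j. w (axis j 1))"
  have col: "column j (P ** Y) = P *v column j Y" for j and P Y :: "'a^'n^'n"
    by (simp add: column_def vec_eq_iff matrix_matrix_mult_def matrix_vector_mult_def)
  have "column j (matpow A k) = column j (matpow A (Suc k) ** X)" for j
  proof -
    have "column j (matpow A k) = matpow A k *v axis j 1"
      by (simp add: vec_eq_iff column_def matrix_vector_mult_def axis_def if_distrib cong: if_cong)
    also have "\<dots> = matpow A (Suc k) *v column j X"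
      unfolding w by (simp add: X_def column_transpose row_def del: matpow.simps)
    finally show ?thesis unfolding col .
  qed
  then have "matpow A k = matpow A (Suc k) ** X"
    by (simp add: vec_eq_iff column_def del: matpow.simps)
  then show ?thesis by blast
qed

lemma transpose_matpow:
  fixes A :: "'a::comm_semiring_1^'n^'n"
  shows "transpose (matpow A k) = matpow (transpose A) k"
  by (induction k) (simp, metis matpow.simps(2) matpow_Suc_right matrix_transpose_mul)

lemma matpow_factor_left:
  fixes A :: "'a::field^'n^'n"
  shows "\<exists>k Y. matpow A k = Y ** matpow A (Suc k)"
proof -
  obtain k X where "matpow (transpose A) k = matpow (transpose A) (Suc k) ** X"
    using matpow_factor_right by blast
  then have "matpow A k = transpose X ** matpow A (Suc k)"
    by (metis matrix_transpose_mul transpose_matpow transpose_transpose)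
  then show ?thesis by blast
qed

text \<open>Let \<open>A\<^sup>k = A\<^sup>k\<^sup>+\<^sup>1 X = Y A\<^sup>k\<^sup>+\<^sup>1\<close>. Although \<open>X\<close> and \<open>Y\<close> need not commute with \<open>A\<close>, the matrix
  \<open>A\<^sup>k X\<^sup>k\<^sup>+\<^sup>1 = Y\<^sup>k\<^sup>+\<^sup>1 A\<^sup>k\<close> does, and it is the Drazin inverse: its first form is suited to
  multiplication by \<open>A\<close> from the left, its second form to multiplication from the right.\<close>

lemma is_drazin_exists:
  fixes A :: "'a::field^'n^'n"
  shows "\<exists>D. is_drazin A D"
proof -
  obtain k1 X where X1: "matpow A k1 = matpow A (Suc k1) ** X"
    using matpow_factor_right by blast
  obtain k2 Y where Y1: "matpow A k2 = Y ** matpow A (Suc k2)"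
    using matpow_factor_left by blast
  \<comment> \<open>Both factorizations persist for larger exponents, so a common one can be chosen.\<close>
  define k where "k = k2 + k1"
  have X: "matpow A k = matpow A (Suc k) ** X"
    using matpow_add[of A k2 k1] matpow_add[of A k2 "Suc k1"] X1
    unfolding k_def by (metis add_Suc_right matrix_mul_assoc)
  have Y: "matpow A k = Y ** matpow A (Suc k)"
    using matpow_add[of A k2 k1] matpow_add[of A "Suc k2" k1] Y1
    unfolding k_def by (metis add_Suc matrix_mul_assoc)
  have comm: "matpow A i ** A = A ** matpow A i" for i
    using matpow_Suc_right[of A i] by simp
  have Xp: "matpow A k = matpow A (j + k) ** matpow X j" for j
  proof (induction j)
    case (Suc j)
    have "matpow A (j + k) = matpow A (Suc j + k) ** X"
      using X matpow_add[of A j k] matpow_add[of A j "Suc k"]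
      by (metis add_Suc add_Suc_right matrix_mul_assoc)
    then show ?case using Suc by (metis matpow.simps(2) matrix_mul_assoc)
  qed simp
  have Yp: "matpow A k = matpow Y j ** matpow A (k + j)" for j
  proof (induction j)
    case (Suc j)
    have "matpow A (k + j) = Y ** matpow A (k + Suc j)"
      using Y matpow_add[of A k j] matpow_add[of A "Suc k" j]
      by (metis add_Suc add_Suc_right matrix_mul_assoc)
    then show ?case using Suc by (metis matpow_Suc_right matrix_mul_assoc)
  qed simp
  have XY: "matpow A k ** matpow X j = matpow Y j ** matpow A k" for j
    using Xp[of j] Yp[of j] by (metis add.commute matpow_add matrix_mul_assoc)
  define D where "D = matpow A k ** matpow X (Suc k)"
  have D2: "D = matpow Y (Suc k) ** matpow A k"
    unfolding D_def by (rule XY)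
  have AD: "A ** D = matpow A k ** matpow X k"
  proof -
    have "A ** D = (matpow A (Suc k) ** X) ** matpow X k"
      unfolding D_def by (simp add: matrix_mul_assoc)
    then show ?thesis by (simp only: X[symmetric])
  qed
  have DA: "D ** A = matpow Y k ** matpow A k"
  proof -
    have "D ** A = matpow Y k ** (Y ** matpow A (Suc k))"
      unfolding D2 matpow_Suc_right by (simp add: matrix_mul_assoc)
    then show ?thesis by (simp only: Y[symmetric])
  qed
  have c: "D ** A = A ** D" unfolding AD DA by (simp add: XY)
  have "D ** A ** D = D"
  proof -
    have "D ** A ** D = (matpow Y k ** matpow A (k + k)) ** matpow X (Suc k)"
      by (simp only: DA matpow_add matrix_mul_assoc) (simp only: D_def matrix_mul_assoc)
    then show ?thesis by (simp only: Yp[of k, symmetric] D_def)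
  qed
  moreover have "D ** matpow A (k + 1) = matpow A k"
  proof -
    have "D ** matpow A (k + 1) = matpow Y (Suc k) ** matpow A (k + Suc k)"
      unfolding D2 matpow_add[of A k "Suc k"] by (simp only: matrix_mul_assoc Suc_eq_plus1)
    then show ?thesis by (simp only: Yp[of "Suc k", symmetric])
  qed
  ultimately show ?thesis using c unfolding is_drazin_def by blast
qed

lemma is_drazin_mono:
  assumes "D ** matpow M (i + 1) = matpow M i" "i \<le> j"
  shows "D ** matpow M (Suc j) = matpow M j"
proof -
  obtain d where d: "j = i + d" using assms(2) le_Suc_ex by blast
  show ?thesis using assms(1) matpow_add[of M i d] matpow_add[of M "i + 1" d]
    by (simp add: d matrix_mul_assoc)
qed

lemma drazin_power:
  assumes "D ** M = M ** D" "D ** M ** D = D"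
  shows "D = matpow D (Suc k) ** matpow M k" and "D = matpow M k ** matpow D (Suc k)"
proof -
  show "D = matpow D (Suc k) ** matpow M k"
  proof (induction k)
    case (Suc k)
    have "matpow D (Suc (Suc k)) ** matpow M (Suc k) = D ** (matpow D (Suc k) ** matpow M k) ** M"
      by (simp only: matpow_Suc_right[of M] matpow.simps(2)[of D "Suc k"] matrix_mul_assoc)
    then show ?case using Suc assms by (metis matrix_mul_assoc)
  qed simp
  then show "D = matpow M k ** matpow D (Suc k)"
    using matpow_commute[OF matpow_commute[OF assms(1), symmetric], of k "Suc k"]
    by simp
qed

text \<open>By \<open>drazin_power\<close>, a Drazin inverse can absorb or release powers of \<open>M\<close> on either side. Once these
  are high enough for the other inverse to cancel, both \<open>D\<close> and \<open>D'\<close> turn out to equal \<open>D M D'\<close>.\<close>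

lemma is_drazin_unique:
  assumes "is_drazin M D" "is_drazin M D'"
  shows "D = D'"
proof -
  have c: "D ** M = M ** D" "D' ** M = M ** D'"
    and i: "D ** M ** D = D" "D' ** M ** D' = D'"
    using assms by (auto simp: is_drazin_def)
  obtain a b where "D ** matpow M (a + 1) = matpow M a" "D' ** matpow M (b + 1) = matpow M b"
    using assms by (auto simp: is_drazin_def)
  then obtain k where k: "D ** matpow M (Suc k) = matpow M k" "D' ** matpow M (Suc k) = matpow M k"
    using is_drazin_mono[of D M a "max a b"] is_drazin_mono[of D' M b "max a b"] by auto
  have k': "matpow M (Suc k) ** D' = matpow M k"
    using k(2) matpow_commute[OF c(2)[symmetric], of "Suc k"] by simp
  have "D = matpow D (Suc k) ** matpow M (Suc k) ** D'"
    using drazin_power(1)[OF c(1) i(1), of k] k' by (metis matrix_mul_assoc)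
  also have "\<dots> = D ** M ** D'"
    using drazin_power(1)[OF c(1) i(1), of k]
    by (metis matpow_Suc_right matrix_mul_assoc)
  also have "\<dots> = D ** M ** matpow M k ** matpow D' (Suc k)"
    using drazin_power(2)[OF c(2) i(2), of k] by (metis matrix_mul_assoc)
  also have "\<dots> = matpow M k ** matpow D' (Suc k)"
    using k(1) by (simp add: matrix_mul_assoc)
  also have "\<dots> = D'" using drazin_power(2)[OF c(2) i(2), of k] by simp
  finally show ?thesis .
qed

lemma is_drazin_drazin: "is_drazin M (drazin M)"
  for M :: "'a::real_or_complex^'n^'n"
proof -
  have "\<exists>!D. is_drazin M D" using is_drazin_exists is_drazin_unique by blast
  then have "is_drazin M (THE D. is_drazin M D)" by (rule theI')
  then show ?thesis unfolding drazin_def is_drazin_def .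
qed

section \<open>The matrix exponential\<close>

lemma norm_vec_le_sum: "norm (x :: 'b::real_normed_vector^'n) \<le> (\<Sum>i\<in>UNIV. norm (x $ i))"
  unfolding norm_vec_def by (rule L2_set_le_sum) simp

lemma norm_matrix_entry_le: "norm (A $ i $ j) \<le> norm (A :: 'b::real_normed_vector^'n^'m)"
  by (rule order_trans[OF Finite_Cartesian_Product.norm_nth_le Finite_Cartesian_Product.norm_nth_le])

lemma bounded_bilinear_matrix_vector_mult:
  "bounded_bilinear ((*v) :: 'a::real_normed_field^'n^'m \<Rightarrow> 'a^'n \<Rightarrow> 'a^'m)"
proof
  show "\<exists>K. \<forall>A x. norm ((A::'a^'n^'m) *v x) \<le> norm A * norm x * K"
  proof (intro exI allI)
    fix A :: "'a^'n^'m" and x :: "'a^'n"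
    have "norm (A *v x) \<le> (\<Sum>i\<in>UNIV. norm ((A *v x) $ i))" by (rule norm_vec_le_sum)
    also have "\<dots> \<le> (\<Sum>i\<in>(UNIV::'m set). \<Sum>j\<in>(UNIV::'n set). norm A * norm x)"
      unfolding matrix_vector_mult_def vec_lambda_beta
      by (intro sum_mono norm_sum[THEN order_trans])
        (simp add: norm_mult mult_mono norm_matrix_entry_le Finite_Cartesian_Product.norm_nth_le)
    finally show "norm (A *v x) \<le> norm A * norm x * (real CARD('m) * real CARD('n))"
      by (simp add: mult_ac)
  qed
qed (simp_all add: vec_eq_iff matrix_vector_mult_def sum.distrib distrib_left distrib_right scaleR_sum_right)

lemma bounded_bilinear_matrix_matrix_mult:
  "bounded_bilinear ((**) :: 'a::real_normed_field^'n^'m \<Rightarrow> 'a^'p^'n \<Rightarrow> 'a^'p^'m)"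
proof
  show "\<exists>K. \<forall>A X. norm ((A::'a^'n^'m) ** (X::'a^'p^'n)) \<le> norm A * norm X * K"
  proof (intro exI allI)
    fix A :: "'a^'n^'m" and X :: "'a^'p^'n"
    have "norm (A ** X) \<le> (\<Sum>i\<in>UNIV. \<Sum>j\<in>UNIV. norm ((A ** X) $ i $ j))"
      by (rule norm_vec_le_sum[THEN order_trans]) (intro sum_mono norm_vec_le_sum)
    also have "\<dots> \<le> (\<Sum>i\<in>(UNIV::'m set). \<Sum>j\<in>(UNIV::'p set). \<Sum>k\<in>(UNIV::'n set). norm A * norm X)"
      unfolding matrix_matrix_mult_def vec_lambda_beta
      by (intro sum_mono norm_sum[THEN order_trans])
        (simp add: norm_mult mult_mono norm_matrix_entry_le)
    finally show "norm (A ** X) \<le> norm A * norm X * (real CARD('m) * real CARD('p) * real CARD('n))"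
      by (simp add: mult_ac)
  qed
qed (simp_all add: vec_eq_iff matrix_matrix_mult_def sum.distrib distrib_left distrib_right scaleR_sum_right)

interpretation mv: bounded_bilinear "(*v) :: 'a::real_normed_field^'n^'m \<Rightarrow> 'a^'n \<Rightarrow> 'a^'m"
  by (rule bounded_bilinear_matrix_vector_mult)

interpretation mm: bounded_bilinear
  "(**) :: 'a::real_normed_field^'n^'m \<Rightarrow> 'a^'p^'n \<Rightarrow> 'a^'p^'m"
  by (rule bounded_bilinear_matrix_matrix_mult)

lemma has_vector_derivative_vec:
  fixes f :: "real \<Rightarrow> 'b::real_normed_vector^'n"
  assumes "\<And>i. ((\<lambda>t. f t $ i) has_vector_derivative f' $ i) F"
  shows "(f has_vector_derivative f') F"
  using assms unfolding has_vector_derivative_def has_derivative_def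
  by (auto intro!: vec_tendstoI bounded_linear_scaleR_left)

lemma matpow_scaleR:
  "matpow (t *\<^sub>R A) k = (t ^ k) *\<^sub>R matpow A k" for A :: "'a::real_normed_field^'n^'n"
  by (induction k) (simp_all add: mm.scaleR_left mm.scaleR_right)

lemma summable_mexp:
  fixes A :: "'a::real_or_complex^'n^'n"
  shows "summable (\<lambda>k. (1 / fact k) *\<^sub>R matpow A k)"
proof -
  obtain K where K: "K > 0" "\<And>X Y. norm ((X::'a^'n^'n) ** (Y::'a^'n^'n)) \<le> norm X * norm Y * K"
    using mm.pos_bounded by blast
  define c where "c = norm A * K"
  have b: "norm (matpow A k) \<le> c ^ k * norm (mat 1 :: 'a^'n^'n)" for k
  proof (induction k)
    case (Suc k)
    have "norm (matpow A (Suc k)) \<le> c * norm (matpow A k)"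
      using K(2)[of A "matpow A k"] by (simp add: c_def mult_ac)
    also have "\<dots> \<le> c * (c ^ k * norm (mat 1 :: 'a^'n^'n))"
      using Suc K(1) by (intro mult_left_mono) (auto simp: c_def)
    finally show ?case by (simp add: mult_ac)
  qed simp
  show ?thesis
  proof (rule summable_comparison_test')
    show "summable (\<lambda>k. (inverse (fact k) * c ^ k) * norm (mat 1 :: 'a^'n^'n))"
      by (intro summable_mult2 summable_exp)
    show "norm ((1 / fact k) *\<^sub>R matpow A k) \<le> (inverse (fact k) * c ^ k) * norm (mat 1 :: 'a^'n^'n)"
      for k using b[of k] by (simp add: divide_simps mult_ac)
  qed
qed

lemma mexp_0: "mexp 0 = (mat 1 :: 'a::real_or_complex^'n^'n)"
proof -
  have "(\<lambda>k. (1 / fact k) *\<^sub>R matpow (0::'a^'n^'n) k) = (\<lambda>k. if k = 0 then mat 1 else 0)"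
    by (rule ext) (auto simp: gr0_conv_Suc)
  then show ?thesis using sums_unique[OF sums_single[of 0 "\<lambda>_. mat 1 :: 'a^'n^'n"]] by (simp add: mexp_def)
qed

lemma mexp_commute:
  assumes "X ** A = A ** X"
  shows "X ** mexp A = mexp A ** X"
proof -
  have "X ** mexp A = (\<Sum>k. X ** ((1 / fact k) *\<^sub>R matpow A k))"
    unfolding mexp_def by (rule bounded_linear.suminf[OF mm.bounded_linear_right summable_mexp])
  also have "\<dots> = (\<Sum>k. ((1 / fact k) *\<^sub>R matpow A k) ** X)"
    using matpow_commute[OF assms[symmetric]] by (simp add: mm.scaleR_left mm.scaleR_right)
  also have "\<dots> = mexp A ** X"
    unfolding mexp_def by (rule bounded_linear.suminf[OF mm.bounded_linear_left summable_mexp, symmetric])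
  finally show ?thesis .
qed

text \<open>Each entry of \<open>mexp (t A)\<close> is an everywhere convergent scalar power series in \<open>t\<close>, so it may be
  differentiated term by term in the scalar field.\<close>

lemma mexp_has_vector_derivative:
  fixes A :: "'a::real_or_complex^'n^'n"
  shows "((\<lambda>t. mexp (t *\<^sub>R A)) has_vector_derivative A ** mexp (t *\<^sub>R A)) (at t within T)"
proof (intro has_vector_derivative_vec)
  fix i j
  define c where "c = (\<lambda>k. (1 / fact k) *\<^sub>R matpow A k $ i $ j)"
  have nth: "suminf f $ i $ j = (\<Sum>k. f k $ i $ j)" "summable (\<lambda>k. f k $ i $ j)" if "summable f" for f :: "nat \<Rightarrow> 'a^'n^'n"
    using bounded_linear.suminf[OF bounded_linear_compose[OF bounded_linear_vec_nth bounded_linear_vec_nth] that, of i j]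
      bounded_linear.summable[OF bounded_linear_compose[OF bounded_linear_vec_nth bounded_linear_vec_nth] that, of i j]
    by auto
  have trm: "((1 / fact k) *\<^sub>R matpow (s *\<^sub>R A) k) $ i $ j = c k * of_real s ^ k" for s k
    by (simp only: c_def matpow_scaleR vector_scaleR_component) (simp add: scaleR_conv_of_real)
  have e: "mexp (s *\<^sub>R A) $ i $ j = (\<Sum>k. c k * of_real s ^ k)" for s
    unfolding mexp_def by (subst nth(1)[OF summable_mexp]) (simp only: trm)
  have sm: "summable (\<lambda>k. c k * y ^ k)" for y
  proof (rule powser_inside)
    show "summable (\<lambda>k. c k * of_real (norm y + 1) ^ k)"
      using nth(2)[OF summable_mexp[of "(norm y + 1) *\<^sub>R A"]] by (simp only: trm)
    show "norm y < norm (of_real (norm y + 1) :: 'a)"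
      by (simp del: of_real_add)
  qed
  have d: "(A ** mexp (t *\<^sub>R A)) $ i $ j = (\<Sum>k. diffs c k * of_real t ^ k)"
  proof -
    have s: "summable (\<lambda>k. A ** ((1 / fact k) *\<^sub>R matpow (t *\<^sub>R A) k))"
      by (rule bounded_linear.summable[OF mm.bounded_linear_right summable_mexp])
    have "A ** mexp (t *\<^sub>R A) = (\<Sum>k. A ** ((1 / fact k) *\<^sub>R matpow (t *\<^sub>R A) k))"
      unfolding mexp_def by (rule bounded_linear.suminf[OF mm.bounded_linear_right summable_mexp])
    then have "(A ** mexp (t *\<^sub>R A)) $ i $ j = (\<Sum>k. (A ** ((1 / fact k) *\<^sub>R matpow (t *\<^sub>R A) k)) $ i $ j)"
      using nth(1)[OF s] by simp
    also have "\<dots> = (\<Sum>k. diffs c k * of_real t ^ k)"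
    proof (rule suminf_cong)
      fix k
      have "(A ** ((1 / fact k) *\<^sub>R matpow (t *\<^sub>R A) k)) $ i $ j
          = (1 / fact k) *\<^sub>R (t ^ k *\<^sub>R matpow A (Suc k) $ i $ j)"
        by (simp add: matpow_scaleR mm.scaleR_right)
      also have "\<dots> = diffs c k * of_real t ^ k"
        by (simp add: diffs_def c_def scaleR_conv_of_real field_simps del: matpow.simps of_nat_Suc)
      finally show "(A ** ((1 / fact k) *\<^sub>R matpow (t *\<^sub>R A) k)) $ i $ j = diffs c k * of_real t ^ k" .
    qed
    finally show ?thesis .
  qed
  show "((\<lambda>t. mexp (t *\<^sub>R A) $ i $ j) has_vector_derivative (A ** mexp (t *\<^sub>R A)) $ i $ j) (at t within T)"
    unfolding e d
    by (rule has_vector_derivative_real_field) (rule termdiffs_strong_converges_everywhere[OF sm])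
qed

section \<open>Singular linear systems\<close>

lemma mat_commute: "mat c ** A = A ** mat c" for A :: "'a::comm_semiring_1^'n^'n"
  by (simp add: vec_eq_iff matrix_matrix_mult_def mat_def if_distrib if_distribR mult.commute cong: if_cong)

lemma mat_mult_vector: "mat c *v v = c *s v" for v :: "'a::comm_semiring_1^'n"
  by (simp add: vec_eq_iff matrix_vector_mult_def mat_def if_distrib if_distribR cong: if_cong)

lemma has_vector_derivative_eq_on_interval:
  assumes "a < b" "t \<in> {a..b}" "\<And>s. s \<in> {a..b} \<Longrightarrow> f s = g s"
    and "(f has_vector_derivative f') (at t within {a..b})"
    and "(g has_vector_derivative g') (at t within {a..b})"
  shows "f' = g'"
proof -
  have "(f has_vector_derivative g') (at t within {a..b})"
    using has_vector_derivative_transform[OF assms(2,3,5)] .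
  then show ?thesis
    using vector_derivative_unique_within_closed_interval[of a b t f f' g'] assms by auto
qed

text \<open>For fixed \<open>t\<close> the curve \<open>s \<mapsto> exp((t - s) G) z(s)\<close> has derivative zero, because \<open>G\<close> commutes with
  its exponential; comparing its values at \<open>s = t\<close> and \<open>s = a\<close> gives the formula without inverting
  the exponential.\<close>

lemma linear_ode_unique:
  fixes G :: "'a::real_or_complex^'n^'n"
  assumes "\<And>s. s \<in> {a..b} \<Longrightarrow> (z has_vector_derivative G *v z s) (at s within {a..b})"
    and t: "t \<in> {a..b}"
  shows "z t = mexp ((t - a) *\<^sub>R G) *v z a"
proof -
  let ?f = "\<lambda>s. mexp ((t - s) *\<^sub>R G) *v z s"
  have "(?f has_vector_derivative 0) (at s within {a..b})" if s: "s \<in> {a..b}" for s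
  proof -
    have "((\<lambda>s. t - s) has_vector_derivative - 1) (at s within {a..b})"
      by (auto intro!: derivative_eq_intros)
    from vector_diff_chain_within[OF this mexp_has_vector_derivative[of G]]
    have "((\<lambda>s. mexp ((t - s) *\<^sub>R G)) has_vector_derivative - (G ** mexp ((t - s) *\<^sub>R G))) (at s within {a..b})"
      by (simp add: o_def)
    from mv.has_vector_derivative[OF this assms(1)[OF s]]
    have "(?f has_vector_derivative mexp ((t - s) *\<^sub>R G) *v (G *v z s)
        + - (G ** mexp ((t - s) *\<^sub>R G)) *v z s) (at s within {a..b})" .
    moreover have "G ** mexp ((t - s) *\<^sub>R G) = mexp ((t - s) *\<^sub>R G) ** G"
      by (rule mexp_commute) (simp add: mm.scaleR_left mm.scaleR_right)
    ultimately show ?thesis by (simp add: matrix_vector_mul_assoc mv.minus_left)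
  qed
  then obtain c where c: "\<And>s. s \<in> {a..b} \<Longrightarrow> ?f s = c"
    using has_vector_derivative_zero_constant[of "{a..b}" ?f] by auto
  have "?f t = ?f a" using c[of t] c[of a] t by auto
  then show ?thesis by (simp add: mexp_0)
qed

context
  fixes N D L G :: "'a::real_or_complex^'n^'n" and \<mu> :: 'a
  assumes D: "is_drazin N D"
    and L: "L = mat 1 - mat \<mu> ** N"
    and G: "G = - (D ** L)"
begin

lemma drazin_commute: "D ** N = N ** D" using D by (simp add: is_drazin_def)

lemma commute_L:
  assumes "X ** N = N ** X" shows "X ** L = L ** X"
proof -
  have "X ** (mat \<mu> ** N) = (mat \<mu> ** N) ** X"
    using assms mat_commute[of \<mu> X] by (metis matrix_mul_assoc)
  then show ?thesis by (simp add: L mm.diff_left mm.diff_right)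
qed

lemma commute_G:
  assumes "X ** N = N ** X" "X ** D = D ** X" shows "X ** G = G ** X"
proof -
  have "X ** (D ** L) = (D ** L) ** X"
    using assms(2) commute_L[OF assms(1)] by (metis matrix_mul_assoc)
  then show ?thesis by (simp add: G mm.minus_left mm.minus_right)
qed

lemma drazin_projection_idem: "(D ** N) ** (D ** N) = D ** N"
  using D unfolding is_drazin_def by (metis matrix_mul_assoc)

text \<open>The exponential commutes with the projection \<open>D N\<close>, so the whole curve stays in its image, where
  \<open>N G = -L (D N)\<close> acts as \<open>-L\<close>.\<close>

lemma singular_system_exp_solution:
  assumes "D ** N *v v = v"
  shows "N *v (G *v (mexp (s *\<^sub>R G) *v v)) = - (L *v (mexp (s *\<^sub>R G) *v v))"
proof -
  have DN: "(D ** N) ** N = N ** (D ** N)" "(D ** N) ** D = D ** (D ** N)"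
    using drazin_commute by (metis matrix_mul_assoc)+
  have "(D ** N) ** mexp (s *\<^sub>R G) = mexp (s *\<^sub>R G) ** (D ** N)"
    by (rule mexp_commute) (simp add: commute_G[OF DN] mm.scaleR_left mm.scaleR_right)
  then have P: "D ** N *v (mexp (s *\<^sub>R G) *v v) = mexp (s *\<^sub>R G) *v v"
    using assms by (metis matrix_vector_mul_assoc)
  have "N ** G = - (L ** (D ** N))"
    using commute_L[OF DN(1)] drazin_commute by (simp add: G mm.minus_right matrix_mul_assoc)
  then have "N *v (G *v w) = - (L *v (D ** N *v w))" for w
    by (simp add: matrix_vector_mul_assoc mv.minus_left)
  then show ?thesis by (simp only: P)
qed

text \<open>The complementary component \<open>P z\<close> of a solution solves the same system and is annihilated by some
  \<open>N\<^sup>\<nu>\<close>. If \<open>N\<^sup>k\<^sup>+\<^sup>1 P z\<close> vanishes on the interval, so does its derivative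
  \<open>N\<^sup>k\<^sup>+\<^sup>1 P z' = -L N\<^sup>k P z\<close>; as \<open>L = I - \<mu> N\<close>, this equals \<open>-N\<^sup>k P z + \<mu> N\<^sup>k\<^sup>+\<^sup>1 P z = -N\<^sup>k P z\<close>. So the
  exponent can be lowered until \<open>P z = 0\<close>. What remains is an ordinary differential equation.\<close>

lemma singular_system_solution_unique:
  assumes ab: "a < b"
    and dz: "\<And>t. t \<in> {a..b} \<Longrightarrow> (z has_vector_derivative z' t) (at t within {a..b})"
    and eq: "\<And>t. t \<in> {a..b} \<Longrightarrow> N *v z' t = - (L *v z t)"
    and t: "t \<in> {a..b}"
  shows "D ** N *v z t = z t" and "z t = mexp ((t - a) *\<^sub>R G) *v z a"
proof -
  define P where "P = mat 1 - D ** N"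
  have PN: "P ** N = N ** P"
  proof -
    have "(D ** N) ** N = N ** (D ** N)" using drazin_commute by (metis matrix_mul_assoc)
    then show ?thesis by (simp only: P_def mm.diff_left mm.diff_right matrix_mul_lid matrix_mul_rid)
  qed
  have Neq: "N *v (P *v z' s) = - (L *v (P *v z s))" if "s \<in> {a..b}" for s
    using eq[OF that] PN commute_L[OF PN] by (metis matrix_vector_mul_assoc mv.minus_right)
  obtain \<nu> where \<nu>: "D ** matpow N (\<nu> + 1) = matpow N \<nu>"
    using D by (auto simp: is_drazin_def)
  have "matpow N \<nu> ** P = 0"
  proof -
    have "matpow N \<nu> ** (D ** N) = D ** matpow N (\<nu> + 1)"
      using matpow_commute[OF drazin_commute[symmetric], of \<nu>] matpow_Suc_right[of N \<nu>]
      by (simp add: matrix_mul_assoc)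
    then show ?thesis using \<nu> by (simp add: P_def mm.diff_right)
  qed
  then have start: "matpow N \<nu> *v (P *v z s) = 0" for s
    by (simp add: matrix_vector_mul_assoc)
  have "\<forall>s\<in>{a..b}. matpow N (\<nu> - j) *v (P *v z s) = 0" for j
  proof (induction j)
    case (Suc j)
    show ?case
    proof (cases "\<nu> \<le> j")
      case False
      define k where "k = \<nu> - Suc j"
      have k: "\<nu> - j = Suc k" using False by (simp add: k_def)
      have IH: "matpow N (Suc k) *v (P *v z s) = 0" if "s \<in> {a..b}" for s
        using Suc that unfolding k by blast
      have "matpow N k *v (P *v z s) = 0" if s: "s \<in> {a..b}" for s
      proof -
        have "((\<lambda>s. matpow N (Suc k) *v (P *v z s)) has_vector_derivative
            matpow N (Suc k) *v (P *v z' s)) (at s within {a..b})"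
          by (intro bounded_linear.has_vector_derivative[OF mv.bounded_linear_right] dz s)
        from has_vector_derivative_eq_on_interval[OF ab s _ this has_vector_derivative_const, of 0] IH
        have "matpow N (Suc k) *v (P *v z' s) = 0" by blast
        then have "matpow N k *v (L *v (P *v z s)) = 0"
          unfolding matpow_Suc_right matrix_vector_mul_assoc[symmetric] Neq[OF s]
          by (simp add: mv.minus_right)
        then have "L *v (matpow N k *v (P *v z s)) = 0"
          using commute_L[OF matpow_commute[of N N k]] by (metis matrix_vector_mul_assoc)
        moreover have "N *v (matpow N k *v (P *v z s)) = 0"
          using IH[OF s] by (simp add: matrix_vector_mul_assoc matrix_mul_assoc)
        ultimately show ?thesis
          by (simp add: L mv.diff_left matrix_vector_mul_assoc[symmetric])
      qed
      then show ?thesis by (simp add: k_def)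
    qed (use Suc in auto)
  qed (use start in simp)
  from this[of \<nu>] have P0: "P *v z s = 0" if "s \<in> {a..b}" for s using that by simp
  then have proj: "D ** N *v z s = z s" if "s \<in> {a..b}" for s
    using that by (simp add: P_def mv.diff_left)
  show "D ** N *v z t = z t" by (rule proj[OF t])
  have "z' s = G *v z s" if s: "s \<in> {a..b}" for s
  proof -
    have "((\<lambda>s. D ** N *v z s) has_vector_derivative D ** N *v z' s) (at s within {a..b})"
      by (intro bounded_linear.has_vector_derivative[OF mv.bounded_linear_right] dz s)
    from has_vector_derivative_eq_on_interval[OF ab s _ this dz[OF s]] proj
    have "D ** N *v z' s = z' s" by blast
    moreover have "D ** N *v z' s = D *v (- (L *v z s))"
      using eq[OF s] by (simp add: matrix_vector_mul_assoc[symmetric])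
    ultimately show ?thesis
      by (simp add: G mv.minus_left mv.minus_right matrix_vector_mul_assoc)
  qed
  then show "z t = mexp ((t - a) *\<^sub>R G) *v z a"
    using linear_ode_unique[of a b z G t] dz t by simp
qed

end

section \<open>Block matrices\<close>

lemma vcat_eq_iff [simp]: "vcat a b = vcat c d \<longleftrightarrow> a = c \<and> b = d"
  unfolding vcat_def vec_eq_iff by (auto split: sum.splits)

lemma vcat_cases: obtains a b where "z = vcat a b"
proof
  show "z = vcat (\<chi> i. z $ Inl i) (\<chi> i. z $ Inr i)"
    by (simp add: vcat_def vec_eq_iff split: sum.split)
qed

lemma vcat_0 [simp]: "vcat 0 0 = (0 :: 'a::zero^('m::finite + 'n::finite))"
  by (simp add: vcat_def vec_eq_iff split: sum.split)

lemma vcat_eq_0_iff [simp]: "vcat a b = 0 \<longleftrightarrow> a = 0 \<and> b = 0"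
  for a :: "'a::zero^'m" and b :: "'a^'n"
  by (simp flip: vcat_0)

lemma vcat_algebra:
  fixes a c :: "'a::real_normed_field^'m" and b d :: "'a^'n"
  shows "vcat a b + vcat c d = vcat (a + c) (b + d)"
    and "vcat a b - vcat c d = vcat (a - c) (b - d)"
    and "- vcat a b = vcat (- a) (- b)"
    and "r *s vcat a b = vcat (r *s a) (r *s b)"
  by (auto simp: vcat_def vec_eq_iff split: sum.split)

lemma sum_UNIV_Plus:
  "(\<Sum>i\<in>(UNIV :: ('m::finite + 'n::finite) set). f i) = (\<Sum>i\<in>UNIV. f (Inl i)) + (\<Sum>i\<in>UNIV. f (Inr i))"
  using sum.Plus[of UNIV UNIV f] by (simp add: o_def)

lemma vcat_mult_vector: "vcat A B *v x = vcat (A *v x) (B *v x)"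
  by (simp add: vcat_def vec_eq_iff matrix_vector_mult_def split: sum.split)

lemma hcat_mult_vcat:
  "hcat A B *v vcat x y = A *v x + (B *v y :: 'a::semiring_1^'r)"
  by (simp add: hcat_def vcat_def vec_eq_iff matrix_vector_mult_def sum_UNIV_Plus)

lemma matrix_inv_mult:
  assumes "invertible A"
  shows "A ** matrix_inv A = mat 1" and "matrix_inv A ** A = mat 1"
  using someI_ex[OF assms[unfolded invertible_def]] by (auto simp: matrix_inv_def)

lemma invertible_iff_ker: "invertible A \<longleftrightarrow> (\<forall>v. A *v v = 0 \<longrightarrow> v = 0)" for A :: "'a::field^'n^'n"
  by (simp add: invertible_left_inverse matrix_left_invertible_ker)

text \<open>The first equation gives \<open>z\<close> in terms of \<open>u\<close>; inserting this into the second leaves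
  the Schur complement applied to \<open>u\<close>.\<close>

lemma schur_complement_solve:
  fixes P :: "'a::real_normed_field^'k^'k" and S :: "'a^'m^'m"
  assumes P: "invertible P"
    and "invertible (S - C ** matrix_inv P ** B)"
  defines "E \<equiv> matrix_inv P" and "T \<equiv> matrix_inv (S - C ** matrix_inv P ** B)"
  shows "P *v z + B *v u = - y \<and> C *v z + S *v u = 0 \<longleftrightarrow>
    z = - ((E + E ** B ** T ** C ** E) *v y) \<and> u = T ** C ** E *v y" (is "?L \<longleftrightarrow> ?R")
proof -
  define Sc where "Sc = S - C ** E ** B"
  have PE: "P *v (E *v w) = w" "E *v (P *v w) = w" for w
    using matrix_inv_mult[OF P] by (simp_all add: E_def matrix_vector_mul_assoc)
  have ST: "Sc *v (T *v w) = w" "T *v (Sc *v w) = w" for w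
    using matrix_inv_mult[OF assms(2)] by (simp_all add: E_def T_def Sc_def matrix_vector_mul_assoc)
  have Sc: "S *v w = Sc *v w + C *v (E *v (B *v w))" for w
    by (simp add: Sc_def mv.diff_left matrix_vector_mul_assoc matrix_mul_assoc)
  have "?L \<longleftrightarrow> z = - (E *v y) - E *v (B *v u) \<and> C *v z + S *v u = 0"
  proof -
    have "P *v z + B *v u = - y \<longleftrightarrow> P *v z = - y - B *v u"
      by (simp add: eq_diff_eq)
    also have "\<dots> \<longleftrightarrow> z = E *v (- y - B *v u)" using PE by metis
    finally show ?thesis by (simp add: mv.diff_right mv.minus_right)
  qed
  also have "\<dots> \<longleftrightarrow> z = - (E *v y) - E *v (B *v u) \<and> Sc *v u = C *v (E *v y)"
    by (auto simp: Sc mv.diff_right mv.minus_right)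
  also have "\<dots> \<longleftrightarrow> z = - (E *v y) - E *v (B *v u) \<and> u = T *v (C *v (E *v y))"
    using ST by metis
  also have "\<dots> \<longleftrightarrow> ?R"
    by (auto simp: matrix_vector_mul_assoc matrix_mul_assoc mv.add_left)
  finally show ?thesis .
qed

section \<open>The optimality system\<close>

lemma cembed_eq_0_iff: "cembed x = 0 \<longleftrightarrow> x = 0"
  unfolding norm_eq_zero[of "cembed x", symmetric] norm_cembed by simp

lemma cembed_sum: "cembed (sum f A) = (\<Sum>i\<in>A. cembed (f i))"
  by (induction A rule: infinite_finite_induct) (simp_all add: cembed_add cembed_eq_0_iff)

lemma in_spectrumI:
  fixes A :: "'a::real_or_complex^'n^'n"
  assumes "A *v v = c *s v" "v \<noteq> 0"
  shows "cembed c \<in> spectrum A"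
proof -
  let ?v = "\<chi> i. cembed (v $ i)"
  have "map_matrix cembed A *v ?v = cembed c *s ?v"
  proof -
    have "(map_matrix cembed A *v ?v) $ i = cembed ((A *v v) $ i)" for i
      by (simp add: matrix_vector_mult_def map_matrix_def cembed_sum cembed_mult)
    then show ?thesis by (simp add: vec_eq_iff assms(1) cembed_mult)
  qed
  moreover have "?v \<noteq> 0"
    using assms(2) by (simp add: vec_eq_iff cembed_eq_0_iff)
  ultimately show ?thesis unfolding spectrum_def by blast
qed

text \<open>A kernel vector \<open>u\<close> of the Schur complement extends by \<open>z = -P\<^sup>-\<^sup>1 B u\<close> to a kernel vector of the
  full block matrix.\<close>

lemma schur_complement_invertible:
  fixes P :: "'a::real_normed_field^'k^'k" and S :: "'a^'m^'m"
  assumes P: "invertible P"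
    and ker: "\<And>z u. P *v z + B *v u = 0 \<Longrightarrow> C *v z + S *v u = 0 \<Longrightarrow> u = 0"
  shows "invertible (S - C ** matrix_inv P ** B)"
  unfolding invertible_iff_ker
proof (intro allI impI)
  fix u assume u: "(S - C ** matrix_inv P ** B) *v u = 0"
  define z where "z = - (matrix_inv P *v (B *v u))"
  have "P *v z + B *v u = 0"
    by (simp add: z_def mv.minus_right matrix_vector_mul_assoc matrix_mul_assoc matrix_inv_mult[OF P])
  moreover have "C *v z + S *v u = 0"
    using u by (simp add: z_def mv.minus_right mv.diff_left matrix_vector_mul_assoc matrix_mul_assoc)
  ultimately show "u = 0" by (rule ker)
qed

lemma antitriangular_invertible:
  fixes X Y W :: "'a::field^'n^'n"
  assumes "invertible X" "invertible Y"
  shows "invertible (block22 0 X Y W)"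
  unfolding invertible_iff_ker
proof (intro allI impI)
  fix v assume v: "block22 0 X Y W *v v = 0"
  obtain a b where ab: "v = vcat a b" by (rule vcat_cases)
  have eqs: "X *v b = 0" "Y *v a + W *v b = 0"
    using v unfolding ab block22_def vcat_mult_vector hcat_mult_vcat
    by auto
  have b: "b = 0" using eqs(1) assms(1) unfolding invertible_iff_ker by blast
  then have "Y *v a = 0" using eqs(2) by simp
  then have "a = 0" using assms(2) unfolding invertible_iff_ker by blast
  then show "v = 0" by (simp add: ab b)
qed

lemma invertible_minus_mat:
  fixes A :: "'a::real_or_complex^'n^'n"
  assumes "cembed c \<notin> spectrum A"
  shows "invertible (A - mat c)"
  unfolding invertible_iff_ker
proof (intro allI impI)
  fix v assume "(A - mat c) *v v = 0"
  then have "A *v v = c *s v" by (simp add: mv.diff_left mat_mult_vector)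
  then show "v = 0" using in_spectrumI assms by blast
qed

lemma invertible_uminus:
  "invertible (- A) \<Longrightarrow> invertible A" for A :: "'a::real_normed_field^'n^'n"
  by (simp only: invertible_iff_ker mv.minus_left neg_equal_0_iff_equal)

lemma E_mat_apply: "E_mat *v vcat l (vcat x u) = vcat x (vcat (- l) 0)"
  by (simp add: E_mat_def vcat_mult_vector hcat_mult_vcat mv.minus_left)

lemma A_mat_apply:
  "A_mat J R Q B S *v vcat l (vcat x u) =
     vcat ((J - R) ** Q *v x + B *v u)
       (vcat (((J - R) ** Q)\<^sup>H *v l + Q ** R ** Q *v x) (B\<^sup>H *v l + S *v u))"
  by (simp add: A_mat_def vcat_mult_vector hcat_mult_vcat)

context
  fixes J R Q :: "'a::real_or_complex^'n^'n"
    and B :: "'a^'m^'n" and S :: "'a^'m^'m" and \<mu> :: 'a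
begin

text \<open>The matrix whose inverse is \<open>E_mu\<close>.\<close>

definition "pencil_block = block22 0 ((J - R) ** Q - mat \<mu>)
                         (((J - R) ** Q)\<^sup>H + mat \<mu>) (Q ** R ** Q)"

text \<open>The matrix taking \<open>z' - \<mu> z\<close> to the control \<open>u\<close>, where \<open>z = (\<lambda>, x)\<close>.\<close>

definition "feedback = matrix_inv (S_mu J R Q B S \<mu>) ** hcat (B\<^sup>H) 0 ** E_mu J R Q \<mu> **
  block22 0 (- mat 1) (mat 1) 0"

lemma pencil_block_apply: "pencil_block *v vcat l x =
   vcat ((J - R) ** Q *v x - mat \<mu> *v x) (((J - R) ** Q)\<^sup>H *v l + mat \<mu> *v l + Q ** R ** Q *v x)"
  by (simp add: pencil_block_def block22_def vcat_mult_vector hcat_mult_vcat mv.diff_left mv.add_left)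

lemma invertible_pencil_block:
  assumes "cembed \<mu> \<notin> spectrum ((J - R) ** Q) \<union> spectrum (- (((J - R) ** Q)\<^sup>H))"
  shows "invertible pencil_block"
  unfolding pencil_block_def
proof (rule antitriangular_invertible)
  show "invertible ((J - R) ** Q - mat \<mu>)"
    using assms by (intro invertible_minus_mat) auto
  have "invertible (- (((J - R) ** Q)\<^sup>H) - mat \<mu>)"
    using assms by (intro invertible_minus_mat) auto
  then have "invertible (- (((J - R) ** Q)\<^sup>H + mat \<mu>))" by simp
  then show "invertible (((J - R) ** Q)\<^sup>H + mat \<mu>)" by (rule invertible_uminus)
qed

lemma invertible_S_mu:
  assumes "invertible pencil_block" "invertible (mat \<mu> ** E_mat - A_mat J R Q B S)"
  shows "invertible (S_mu J R Q B S \<mu>)"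
  unfolding S_mu_def E_mu_def pencil_block_def[symmetric]
proof (rule schur_complement_invertible[OF assms(1)])
  fix z u
  assume 1: "pencil_block *v z + vcat B 0 *v u = 0" and 2: "hcat (B\<^sup>H) 0 *v z + S *v u = 0"
  obtain l x where z: "z = vcat l x" by (rule vcat_cases)
  have "(mat \<mu> ** E_mat - A_mat J R Q B S) *v vcat l (vcat x u) = 0"
    using 1 2 unfolding z pencil_block_apply matrix_vector_mult_diff_rdistrib
      matrix_vector_mul_assoc[symmetric] E_mat_apply A_mat_apply
    by (simp add: vcat_mult_vector hcat_mult_vcat vcat_algebra mat_mult_vector)
      (simp add: matrix_vector_mul_assoc algebra_simps neg_eq_iff_add_eq_0)
  then have "vcat l (vcat x u) = 0" using assms(2) unfolding invertible_iff_ker by blast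
  then show "u = 0" by simp
qed

text \<open>With
  \<open>y = K (z' - \<mu> z)\<close> the system takes the form solved by \<open>schur_complement_solve\<close>, and its
  solution formula for \<open>z\<close> is \<open>z = -N\<^sub>\<mu> (z' - \<mu> z)\<close>.\<close>

lemma optimality_system_iff:
  assumes P: "invertible pencil_block" and S\<mu>: "invertible (S_mu J R Q B S \<mu>)"
  defines "N \<equiv> N_mu J R Q B S \<mu>"
  shows "E_mat *v vcat l' (vcat x' u') = A_mat J R Q B S *v vcat l (vcat x u) \<longleftrightarrow>
    N *v vcat l' x' = - ((mat 1 - mat \<mu> ** N) *v vcat l x) \<and>
    u = feedback *v (vcat l' x' - mat \<mu> *v vcat l x)"
proof -
  define y where "y = block22 0 (- mat 1) (mat 1) 0 *v (vcat l' x' - mat \<mu> *v vcat l x)"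
  have y: "y = vcat (mat \<mu> *v x - x') (l' - mat \<mu> *v l)"
    by (simp add: y_def mat_mult_vector vcat_algebra block22_def vcat_mult_vector hcat_mult_vcat
        mv.minus_left)
  have "E_mat *v vcat l' (vcat x' u') = A_mat J R Q B S *v vcat l (vcat x u) \<longleftrightarrow>
    pencil_block *v vcat l x + vcat B 0 *v u = - y \<and> hcat (B\<^sup>H) 0 *v vcat l x + S *v u = 0"
    unfolding y E_mat_apply A_mat_apply pencil_block_apply
    by (auto simp: vcat_mult_vector hcat_mult_vcat vcat_algebra algebra_simps neg_eq_iff_add_eq_0)
  also have "\<dots> \<longleftrightarrow> vcat l x = - (N *v (vcat l' x' - mat \<mu> *v vcat l x)) \<and>
    u = feedback *v (vcat l' x' - mat \<mu> *v vcat l x)"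
    unfolding schur_complement_solve[OF P S\<mu>[unfolded S_mu_def E_mu_def pencil_block_def[symmetric]]]
    by (simp only: N_def N_mu_def feedback_def y_def S_mu_def E_mu_def pencil_block_def[symmetric]
        matrix_vector_mul_assoc)
  also have "vcat l x = - (N *v (vcat l' x' - mat \<mu> *v vcat l x)) \<longleftrightarrow>
     N *v vcat l' x' = - ((mat 1 - mat \<mu> ** N) *v vcat l x)"
  proof -
    have "(mat 1 - mat \<mu> ** N) *v vcat l x = vcat l x - N *v (mat \<mu> *v vcat l x)"
      by (simp only: mv.diff_left mat_commute matrix_vector_mul_lid matrix_vector_mul_assoc)
    moreover have "a = - (p - q) \<longleftrightarrow> p = - (a - q)" for a p q :: "'a^('n + 'n)" by auto
    ultimately show ?thesis by (simp only: mv.diff_right)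
  qed
  finally show ?thesis .
qed

end

theorem proposition4p3:
  fixes J R Q :: "'a::real_or_complex^'n^'n"
    and B :: "'a^'m^'n"
    and S :: "'a^'m^'m"
    and \<mu> :: 'a
    and t0 t1 :: real
    and x0 x1 :: "'a^'n"
    and E1 E2 E3 E4 :: "real \<Rightarrow> 'a^'n^'n"
  assumes "t0 < t1"
    and "(J, R, Q, B) \<in> Sigma_nm"
    and "S\<^sup>H = S" and "psd S"
    and "cembed \<mu> \<notin> spectrum ((J - R) ** Q) \<union> spectrum (- (((J - R) ** Q)\<^sup>H))"
    and "invertible (mat \<mu> ** E_mat - A_mat J R Q B S)"
    and "\<forall>t. mexp (- ((t - t0) *\<^sub>R (drazin (N_mu J R Q B S \<mu>)
                          ** (mat 1 - mat \<mu> ** N_mu J R Q B S \<mu>))))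
             = block22 (E1 t) (E2 t) (E3 t) (E4 t)"
    and "invertible (E3 t1)"
  shows "(\<exists>l x u. dae_solution E_mat (A_mat J R Q B S) t0 t1
                     (\<lambda>t. vcat (l t) (vcat (x t) (u t)))
                 \<and> x t0 = x0 \<and> x t1 = x1)
         \<longleftrightarrow>
         vcat (matrix_inv (E3 t1) *v (x1 - E4 t1 *v x0)) x0
           \<in> range ((*v) (drazin (N_mu J R Q B S \<mu>) ** N_mu J R Q B S \<mu>))"
proof -
  define N where "N = N_mu J R Q B S \<mu>"
  define D where "D = drazin N"
  define L where "L = mat 1 - mat \<mu> ** N"
  define G where "G = - (D ** L)"
  define l0 where "l0 = matrix_inv (E3 t1) *v (x1 - E4 t1 *v x0)"
  have D: "is_drazin N D" unfolding D_def by (rule is_drazin_drazin)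
  note ctx = D L_def G_def
  have P: "invertible (pencil_block J R Q \<mu>)" by (rule invertible_pencil_block[OF assms(5)])
  note system = optimality_system_iff[OF P invertible_S_mu[OF P assms(6)], folded N_def, folded L_def]
  have expG: "mexp ((t - t0) *\<^sub>R G) = block22 (E1 t) (E2 t) (E3 t) (E4 t)" for t
    using assms(7) by (simp add: G_def L_def D_def N_def)
  have E3: "E3 t1 *v l = x1 - E4 t1 *v x0 \<longleftrightarrow> l = l0" for l
    using matrix_inv_mult[OF assms(8)] unfolding l0_def
    by (metis matrix_vector_mul_assoc matrix_vector_mul_lid)
  show ?thesis
    unfolding N_def[symmetric] D_def[symmetric] l0_def[symmetric]
  proof
    assume "\<exists>l x u. dae_solution E_mat (A_mat J R Q B S) t0 t1 (\<lambda>t. vcat (l t) (vcat (x t) (u t)))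
              \<and> x t0 = x0 \<and> x t1 = x1"
    then obtain l x u where sol: "dae_solution E_mat (A_mat J R Q B S) t0 t1
        (\<lambda>t. vcat (l t) (vcat (x t) (u t)))" and x0: "x t0 = x0" and x1: "x t1 = x1" by blast
    let ?w = "\<lambda>t. vcat (l t) (vcat (x t) (u t))" and ?z = "\<lambda>t. vcat (l t) (x t)"
    obtain w' where w': "\<And>t. t \<in> {t0..t1} \<Longrightarrow> (?w has_vector_derivative w' t) (at t within {t0..t1})"
      using sol unfolding dae_solution_def C1_on_def by blast
    have Ew: "E_mat *v w' t = A_mat J R Q B S *v ?w t" if t: "t \<in> {t0..t1}" for t
    proof (rule has_vector_derivative_eq_on_interval[OF assms(1) t refl])
      show "((\<lambda>s. E_mat *v ?w s) has_vector_derivative E_mat *v w' t) (at t within {t0..t1})"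
        by (intro bounded_linear.has_vector_derivative[OF mv.bounded_linear_right] w' t)
      show "((\<lambda>s. E_mat *v ?w s) has_vector_derivative A_mat J R Q B S *v ?w t) (at t within {t0..t1})"
        using sol t unfolding dae_solution_def by blast
    qed
    \<comment> \<open>The projection onto the components \<open>(\<lambda>, x)\<close>.\<close>
    define T :: "'a^('n + ('n + 'm))^('n + 'n)"
      where "T = vcat (hcat (mat 1) 0) (hcat 0 (hcat (mat 1) 0))"
    have T: "T *v vcat a (vcat b c) = vcat a b" for a b c
      by (simp add: T_def vcat_mult_vector hcat_mult_vcat)
    have dz: "(?z has_vector_derivative T *v w' t) (at t within {t0..t1})" if "t \<in> {t0..t1}" for t
      using bounded_linear.has_vector_derivative[OF mv.bounded_linear_right w'[OF that], of T]
      by (simp only: T)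
    have Nz: "N *v (T *v w' t) = - (L *v ?z t)" if t: "t \<in> {t0..t1}" for t
    proof -
      obtain l' q where q: "w' t = vcat l' q" by (rule vcat_cases)
      obtain x' u' where "q = vcat x' u'" by (rule vcat_cases)
      with q have w: "w' t = vcat l' (vcat x' u')" by simp
      show ?thesis using Ew[OF t] unfolding w system T by blast
    qed
    note unique = singular_system_solution_unique[OF ctx assms(1) dz Nz]
    have "?z t1 = mexp ((t1 - t0) *\<^sub>R G) *v ?z t0" using assms(1) by (intro unique(2)) auto
    then have "x1 = E3 t1 *v l t0 + E4 t1 *v x0"
      by (simp add: expG block22_def vcat_mult_vector hcat_mult_vcat x0 x1)
    then have "E3 t1 *v l t0 = x1 - E4 t1 *v x0" by simp
    then have "l t0 = l0" by (simp only: E3)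
    moreover have "D ** N *v ?z t0 = ?z t0" using assms(1) by (intro unique(1)) auto
    ultimately show "vcat l0 x0 \<in> range ((*v) (D ** N))" using x0 by (metis rangeI)
  next
    assume "vcat l0 x0 \<in> range ((*v) (D ** N))"
    then have proj: "D ** N *v vcat l0 x0 = vcat l0 x0"
      using drazin_projection_idem[OF D] by (auto simp: matrix_vector_mul_assoc)
    define z where "z = (\<lambda>t. mexp ((t - t0) *\<^sub>R G) *v vcat l0 x0)"
    have dz: "(z has_vector_derivative G *v z t) (at t within {t0..t1})" for t
    proof -
      have "((\<lambda>t. t - t0) has_vector_derivative 1) (at t within {t0..t1})"
        by (auto intro!: derivative_eq_intros)
      from vector_diff_chain_within[OF this mexp_has_vector_derivative[of G]]
      have "((\<lambda>t. mexp ((t - t0) *\<^sub>R G)) has_vector_derivative G ** mexp ((t - t0) *\<^sub>R G)) (at t within {t0..t1})"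
        by (simp add: o_def)
      from bounded_linear.has_vector_derivative[OF mv.bounded_linear_left this]
      show ?thesis by (simp add: z_def matrix_vector_mul_assoc)
    qed
    \<comment> \<open>Along \<open>z\<close> one has \<open>z' - \<mu> z = (G - \<mu> I) z\<close>, so the control, and with it the whole
      trajectory, is a constant matrix applied to \<open>z\<close>; in particular it is smooth.\<close>
    define U where "U = feedback J R Q B S \<mu> ** (G - mat \<mu>)"
    define W where "W = vcat (hcat (mat 1) 0) (vcat (hcat 0 (mat 1)) U)"
    define l where "l = (\<lambda>t. hcat (mat 1) 0 *v z t)"
    define x where "x = (\<lambda>t. hcat 0 (mat 1) *v z t)"
    define u where "u = (\<lambda>t. U *v z t)"
    have lx: "vcat (l t) (x t) = z t" for t
      by (rule vcat_cases[of "z t"]) (simp add: l_def x_def hcat_mult_vcat)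
    have W: "vcat (l t) (vcat (x t) (u t)) = W *v z t" for t
      by (simp add: W_def vcat_mult_vector l_def x_def u_def)
    have dw: "((\<lambda>t. vcat (l t) (vcat (x t) (u t))) has_vector_derivative W *v (G *v z t)) (at t within {t0..t1})" for t
      unfolding W by (intro bounded_linear.has_vector_derivative[OF mv.bounded_linear_right] dz)
    have EA: "E_mat *v (W *v (G *v z t)) = A_mat J R Q B S *v vcat (l t) (vcat (x t) (u t))" for t
    proof -
      obtain l' x' where q: "G *v z t = vcat l' x'" by (rule vcat_cases)
      have W': "W *v (G *v z t) = vcat l' (vcat x' (U *v vcat l' x'))"
        by (simp add: W_def vcat_mult_vector hcat_mult_vcat q)
      show ?thesis
        unfolding W' system
        unfolding lx q[symmetric]
        using singular_system_exp_solution[OF ctx proj, of "t - t0"]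
        by (simp add: z_def u_def U_def mv.diff_left flip: matrix_vector_mul_assoc)
    qed
    have "continuous_on {t0..t1} z"
      using dz by (rule continuous_on_vector_derivative)
    then have "C1_on t0 t1 (\<lambda>t. vcat (l t) (vcat (x t) (u t)))"
      unfolding C1_on_def using dw
      by (intro exI[of _ "\<lambda>t. W *v (G *v z t)"] conjI ballI mv.continuous_on continuous_on_const) auto
    moreover have "((\<lambda>s. E_mat *v vcat (l s) (vcat (x s) (u s))) has_vector_derivative
        A_mat J R Q B S *v vcat (l t) (vcat (x t) (u t))) (at t within {t0..t1})" for t
      using bounded_linear.has_vector_derivative[OF mv.bounded_linear_right dw, of E_mat t]
      unfolding EA .
    ultimately have "dae_solution E_mat (A_mat J R Q B S) t0 t1 (\<lambda>t. vcat (l t) (vcat (x t) (u t)))"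
      unfolding dae_solution_def by blast
    moreover have "x t0 = x0"
      by (simp add: x_def z_def mexp_0 hcat_mult_vcat)
    moreover have "x t1 = E3 t1 *v l0 + E4 t1 *v x0"
      by (simp add: x_def z_def expG block22_def vcat_mult_vector hcat_mult_vcat)
    then have "x t1 = x1" using E3[of l0] by simp
    ultimately show "\<exists>l x u. dae_solution E_mat (A_mat J R Q B S) t0 t1 (\<lambda>t. vcat (l t) (vcat (x t) (u t)))
              \<and> x t0 = x0 \<and> x t1 = x1" by blast
  qed
qed

end
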